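(* Let $n\ge 2$, let $L^n(-1)$ be the $n$-dimensional Lobachevsky (hyperbolic) space of constant curvature $-1$, and let $\rho$ be the distance function generated by its Riemannian metric. Then the Steiner ratio of $L^n(-1)$ does not exceed $3/4$, that is, $m(L^n(-1),\rho)\le 3/4$.
   Context: For a metric space $(X,\rho)$ and a finite nonempty subset $N\subset X$, $\rho(\mathrm{MST}_N)$ denotes the least weight of a spanning tree of the complete graph on $N$, where the edge $xy$ has weight $\rho(x,y)$ and the weight of a graph is the sum of the weights of its edges. Further, $\rho(\mathrm{SMT}_N)=\inf\rho(\mathrm{MST}_{\bar N})$, the infimum being over all finite subsets $\bar N\subset X$ with $\bar N\supset N$ (whether or not it is attained). The Steiner ratio of $(X,\rho)$ (a space with at least two points) is $m(X,\rho)=\inf_N \rho(\mathrm{SMT}_N)/\rho(\mathrm{MST}_N)$, the infimum being over all finite subsets $N\subset X$ with at least two points. *)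

theory Defs
  imports "HOL-Analysis.Analysis"
begin

section \<open>Spanning trees and the Steiner ratio\<close>

text \<open>A finite simple graph on a vertex set \<open>N\<close> is given by its symmetric irreflexive adjacency
  relation \<open>E\<close>, so that every edge \<open>xy\<close> occurs in \<open>E\<close> as the two pairs \<open>(x, y)\<close> and \<open>(y, x)\<close>.\<close>

definition simple_graph_on :: "'a set \<Rightarrow> ('a \<times> 'a) set \<Rightarrow> bool" where
  "simple_graph_on N E \<longleftrightarrow> E \<subseteq> N \<times> N \<and> sym E \<and> irrefl E"

definition connected_graph_on :: "'a set \<Rightarrow> ('a \<times> 'a) set \<Rightarrow> bool" where
  "connected_graph_on N E \<longleftrightarrow> (\<forall>x\<in>N. \<forall>y\<in>N. (x, y) \<in> E\<^sup>*)"

definition graph_cycle :: "('a \<times> 'a) set \<Rightarrow> 'a list \<Rightarrow> bool" where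
  "graph_cycle E xs \<longleftrightarrow> 3 \<le> length xs \<and> distinct xs \<and>
     (\<forall>i<length xs. (xs ! i, xs ! (Suc i mod length xs)) \<in> E)"

definition spanning_tree_on :: "'a set \<Rightarrow> ('a \<times> 'a) set \<Rightarrow> bool" where
  "spanning_tree_on N E \<longleftrightarrow>
     simple_graph_on N E \<and> connected_graph_on N E \<and> (\<nexists>xs. graph_cycle E xs)"

text \<open>The factor \<open>1/2\<close> compensates for each edge being counted in both orientations.\<close>

definition graph_weight :: "('a \<Rightarrow> 'a \<Rightarrow> real) \<Rightarrow> ('a \<times> 'a) set \<Rightarrow> real" where
  "graph_weight \<rho> E = (\<Sum>(x, y)\<in>E. \<rho> x y) / 2"

definition mst_weight :: "('a \<Rightarrow> 'a \<Rightarrow> real) \<Rightarrow> 'a set \<Rightarrow> real" where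
  "mst_weight \<rho> N = Min (graph_weight \<rho> ` {E. spanning_tree_on N E})"

definition smt_weight :: "'a set \<Rightarrow> ('a \<Rightarrow> 'a \<Rightarrow> real) \<Rightarrow> 'a set \<Rightarrow> real" where
  "smt_weight X \<rho> N = Inf {mst_weight \<rho> M |M. finite M \<and> N \<subseteq> M \<and> M \<subseteq> X}"

definition steiner_ratio :: "'a set \<Rightarrow> ('a \<Rightarrow> 'a \<Rightarrow> real) \<Rightarrow> real" where
  "steiner_ratio X \<rho> =
     Inf {smt_weight X \<rho> N / mst_weight \<rho> N |N. finite N \<and> N \<subseteq> X \<and> 2 \<le> card N}"

section \<open>Riemannian distance on an open subset of a Euclidean space\<close>

text \<open>A Riemannian metric on an open set is a function \<open>g\<close> sending a point \<open>p\<close> to the inner product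
  \<open>g p\<close> on the tangent space at \<open>p\<close>.  The length of a curve is specified as a relation: for the
  library's piecewise \<open>C\<^sup>1\<close> curves the speed may be unbounded near the finitely many exceptional
  parameters, and a curve whose speed is not integrable has no (finite) length.\<close>

definition has_riemannian_length ::
    "('a::euclidean_space \<Rightarrow> 'a \<Rightarrow> 'a \<Rightarrow> real) \<Rightarrow> (real \<Rightarrow> 'a) \<Rightarrow> real \<Rightarrow> bool" where
  "has_riemannian_length g c l \<longleftrightarrow>
     ((\<lambda>t. sqrt (g (c t) (vector_derivative c (at t)) (vector_derivative c (at t))))
        has_integral l) {0..1}"

definition riemannian_dist ::
    "'a::euclidean_space set \<Rightarrow> ('a \<Rightarrow> 'a \<Rightarrow> 'a \<Rightarrow> real) \<Rightarrow> 'a \<Rightarrow> 'a \<Rightarrow> real" where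
  "riemannian_dist U g x y =
     Inf {l. \<exists>c. c piecewise_C1_differentiable_on {0..1} \<and> path_image c \<subseteq> U \<and>
                 pathstart c = x \<and> pathfinish c = y \<and> has_riemannian_length g c l}"

section \<open>Lobachevsky space\<close>

text \<open>The Poincare ball model: the open unit ball with the metric \<open>4 |dx|\<^sup>2 / (1 - |x|\<^sup>2)\<^sup>2\<close>, whose
  sectional curvature is constantly \<open>-1\<close>.  The dimension is \<open>CARD('n)\<close>.\<close>

definition lobachevsky_space :: "(real ^ 'n) set" where
  "lobachevsky_space = ball 0 1"

definition lobachevsky_metric :: "real ^ 'n \<Rightarrow> real ^ 'n \<Rightarrow> real ^ 'n \<Rightarrow> real" where
  "lobachevsky_metric p u v = 4 * (u \<bullet> v) / (1 - (norm p)\<^sup>2)\<^sup>2"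

definition lobachevsky_dist :: "real ^ 'n \<Rightarrow> real ^ 'n \<Rightarrow> real" where
  "lobachevsky_dist = riemannian_dist lobachevsky_space lobachevsky_metric"

end

theory Submission
  imports Defs "HOL-Real_Asymp.Real_Asymp"
begin

text \<open>
  Let \<open>u, v\<close> be orthogonal unit vectors and let \<open>N\<close> consist of the points at hyperbolic distance
  \<open>r\<close> from the origin in the directions \<open>u, v, -u\<close>.  The star centred at the origin shows
  \<open>\<rho>(SMT\<^sub>N) \<le> 3 r\<close>.  In the other direction, the Busemann functions are 1-Lipschitz, and the one
  belonging to a direction \<open>w\<close> is \<open>r\<close> at the point of \<open>N\<close> in direction \<open>w\<close> and at most \<open>-r + ln 2\<close>
  at a point whose direction makes an angle of at least \<open>\<pi>/2\<close> with \<open>w\<close>.  So the points of \<open>N\<close> are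
  at distance at least \<open>2 r - ln 2\<close> from each other and \<open>\<rho>(MST\<^sub>N) \<ge> 2 (2 r - ln 2)\<close>.  Let \<open>r\<close> tend
  to infinity.
\<close>

section \<open>Weights of spanning trees\<close>

definition star_graph :: "'a \<Rightarrow> 'a set \<Rightarrow> ('a \<times> 'a) set" where
  "star_graph a M = Pair a ` (M - {a}) \<union> (\<lambda>x. (x, a)) ` (M - {a})"

lemma star_graph_iff:
  "(x, y) \<in> star_graph a M \<longleftrightarrow> x = a \<and> y \<in> M - {a} \<or> y = a \<and> x \<in> M - {a}"
  by (auto simp: star_graph_def)

text \<open>The star has two uses: its weight bounds \<open>mst_weight\<close> from above, and its
  existence makes the set under \<open>Min\<close> nonempty. Every edge contains \<open>a\<close>,
  whereas a cycle passes \<open>a\<close> at most once and so has an edge avoiding it.\<close>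

lemma spanning_tree_star_graph:
  assumes "a \<in> M"
  shows "spanning_tree_on M (star_graph a M)"
  unfolding spanning_tree_on_def
proof (intro conjI notI)
  show "simple_graph_on M (star_graph a M)"
    using assms by (auto simp: simple_graph_on_def star_graph_iff sym_def irrefl_def)
  have "(x, a) \<in> (star_graph a M)\<^sup>*" "(a, x) \<in> (star_graph a M)\<^sup>*" if "x \<in> M" for x
    using that by (cases "x = a"; auto simp: star_graph_iff intro!: r_into_rtrancl)+
  then show "connected_graph_on M (star_graph a M)"
    unfolding connected_graph_on_def by (meson rtrancl_trans)
  assume "\<exists>xs. graph_cycle (star_graph a M) xs"
  then obtain xs where len: "3 \<le> length xs" and dist: "distinct xs"
    and edge: "\<And>i. i < length xs \<Longrightarrow> (xs ! i, xs ! (Suc i mod length xs)) \<in> star_graph a M"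
    unfolding graph_cycle_def by blast
  have e0: "(xs ! 0, xs ! 1) \<in> star_graph a M" and e1: "(xs ! 1, xs ! 2) \<in> star_graph a M"
    using edge[of 0] edge[of 1] len by (force simp: numeral_2_eq_2)+
  have ne: "xs ! i \<noteq> xs ! j" if "i \<noteq> j" "i < length xs" "j < length xs" for i j
    using dist that by (simp add: nth_eq_iff_index_eq)
  have "xs ! 0 \<noteq> xs ! 2" "xs ! 1 \<noteq> xs ! 2"
    by (rule ne; use len in linarith)+
  \<comment> \<open>Otherwise both \<open>xs ! 0\<close> and \<open>xs ! 2\<close> would have to be
    \<open>a\<close>.\<close>
  with e0 e1 have "xs ! 1 = a"
    by (auto simp: star_graph_iff)
  moreover have "(xs ! 2, xs ! (3 mod length xs)) \<in> star_graph a M"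
    using edge[of 2] len by (simp add: numeral_3_eq_3)
  \<comment> \<open>The next index is 0 in a triangle and 3 in a longer cycle, never 1; so the edge
    leaving \<open>xs ! 2\<close> avoids \<open>a\<close>.\<close>
  moreover have "xs ! 1 \<noteq> xs ! (3 mod length xs)"
  proof (rule ne)
    show "1 \<noteq> 3 mod length xs"
      using len by (cases "length xs = 3") auto
    show "1 < length xs" "3 mod length xs < length xs"
      using len by (linarith, intro mod_less_divisor, linarith)
  qed
  ultimately show False
    using \<open>xs ! 1 \<noteq> xs ! 2\<close> by (auto simp: star_graph_iff)
qed

lemma finite_spanning_trees:
  assumes "finite M"
  shows "finite {E. spanning_tree_on M E}"
  by (rule finite_subset[of _ "Pow (M \<times> M)"])
    (use assms in \<open>auto simp: spanning_tree_on_def simple_graph_on_def\<close>)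

text \<open>Both \<open>\<rho> a x\<close> and \<open>\<rho> x a\<close> appear because
  \<open>\<rho>\<close> is an arbitrary function here; the halving is the one in
  \<open>graph_weight\<close>.\<close>

lemma mst_weight_le_star:
  assumes "finite M" "a \<in> M"
  shows "mst_weight \<rho> M \<le> (\<Sum>x\<in>M - {a}. \<rho> a x + \<rho> x a) / 2"
proof -
  have "mst_weight \<rho> M \<le> graph_weight \<rho> (star_graph a M)"
    unfolding mst_weight_def
    using assms by (intro Min_le finite_imageI finite_spanning_trees imageI CollectI
        spanning_tree_star_graph)
  also have "(\<Sum>(x, y)\<in>star_graph a M. \<rho> x y)
      = (\<Sum>(x, y)\<in>Pair a ` (M - {a}). \<rho> x y) + (\<Sum>(x, y)\<in>(\<lambda>x. (x, a)) ` (M - {a}). \<rho> x y)"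
    unfolding star_graph_def using assms by (intro sum.union_disjoint) auto
  then have "graph_weight \<rho> (star_graph a M) = (\<Sum>x\<in>M - {a}. \<rho> a x + \<rho> x a) / 2"
    by (simp add: graph_weight_def sum.reindex inj_on_def sum.distrib)
  finally show ?thesis .
qed

lemma le_mst_weightI:
  assumes "finite M" "M \<noteq> {}" "\<And>E. spanning_tree_on M E \<Longrightarrow> b \<le> graph_weight \<rho> E"
  shows "b \<le> mst_weight \<rho> M"
proof -
  from assms(2) obtain a where "a \<in> M"
    by blast
  with assms show ?thesis
    unfolding mst_weight_def
    by (subst Min_ge_iff) (auto intro!: finite_imageI finite_spanning_trees spanning_tree_star_graph)
qed

lemma mst_weight_nonneg:
  assumes "finite M" "M \<noteq> {}" "\<And>x y. x \<in> M \<Longrightarrow> y \<in> M \<Longrightarrow> 0 \<le> \<rho> x y"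
  shows "0 \<le> mst_weight \<rho> M"
  using assms(1,2)
proof (rule le_mst_weightI)
  fix E assume "spanning_tree_on M E"
  then show "0 \<le> graph_weight \<rho> E"
    unfolding graph_weight_def spanning_tree_on_def simple_graph_on_def
    by (auto intro!: sum_nonneg assms(3))
qed

text \<open>Every vertex other than a fixed root has a neighbour closer to the root; these edges are
  pairwise distinct because the graph distance to the root orients them.\<close>

lemma card_connected_graph:
  assumes "finite N" "N \<noteq> {}" "simple_graph_on N E" "connected_graph_on N E"
  shows "2 * (card N - 1) \<le> card E"
proof -
  from assms(2) obtain r where r: "r \<in> N"
    by blast
  have E: "E \<subseteq> N \<times> N" "sym E"
    using assms(3) by (auto simp: simple_graph_on_def)
  define d where "d x = (LEAST k. (r, x) \<in> E ^^ k)" for x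
  have "\<exists>p. (p, x) \<in> E \<and> d p < d x" if "x \<in> N - {r}" for x
  proof -
    have "(r, x) \<in> E\<^sup>*"
      using assms(4) r that by (auto simp: connected_graph_on_def)
    then have dx: "(r, x) \<in> E ^^ d x"
      unfolding d_def by (metis LeastI rtrancl_imp_relpow)
    with that obtain k where k: "d x = Suc k"
      by (cases "d x") auto
    with dx obtain p where "(r, p) \<in> E ^^ k" "(p, x) \<in> E"
      by auto
    moreover from this have "d p \<le> k"
      unfolding d_def by (intro Least_le)
    ultimately show ?thesis
      using k by auto
  qed
  then obtain p where p: "\<And>x. x \<in> N - {r} \<Longrightarrow> (p x, x) \<in> E \<and> d (p x) < d x"
    by metis
  \<comment> \<open>The parent edges in their two orientations, whence the factor 2. A pair in both
    sets would give vertices \<open>x\<close> and \<open>y\<close> with \<open>d x < d y\<close> and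
    \<open>d y < d x\<close>.\<close>
  define A B where "A = (\<lambda>x. (p x, x)) ` (N - {r})" and "B = (\<lambda>x. (x, p x)) ` (N - {r})"
  have "card A = card N - 1" "card B = card N - 1"
    using assms(1) r by (auto simp: A_def B_def card_image inj_on_def)
  moreover have "A \<inter> B = {}"
    using p by (auto simp: A_def B_def) (metis DiffI not_less_iff_gr_or_eq singletonD)
  moreover have "finite A" "finite B"
    using assms(1) by (auto simp: A_def B_def)
  ultimately have "card (A \<union> B) = 2 * (card N - 1)"
    by (simp add: card_Un_disjoint)
  moreover have "A \<union> B \<subseteq> E"
    using p E(2) by (auto simp: A_def B_def sym_def)
  moreover have "finite E"
    using E(1) assms(1) by (meson finite_SigmaI finite_subset)
  ultimately show ?thesis
    by (metis card_mono)
qed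

lemma mst_weight_ge:
  assumes "finite N" "N \<noteq> {}" "0 \<le> L"
    and "\<And>x y. x \<in> N \<Longrightarrow> y \<in> N \<Longrightarrow> x \<noteq> y \<Longrightarrow> L \<le> \<rho> x y"
  shows "real (card N - 1) * L \<le> mst_weight \<rho> N"
  using assms(1,2)
proof (rule le_mst_weightI)
  fix E assume E: "spanning_tree_on N E"
  then have "2 * (card N - 1) \<le> card E"
    using assms(1,2) by (intro card_connected_graph) (auto simp: spanning_tree_on_def)
  then have "real (2 * (card N - 1)) * L \<le> real (card E) * L"
    using assms(3) by (intro mult_right_mono of_nat_mono)
  also have "\<dots> \<le> (\<Sum>(x, y)\<in>E. \<rho> x y)"
    using E by (intro sum_bounded_below)
      (auto simp: spanning_tree_on_def simple_graph_on_def irrefl_def intro!: assms(4))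
  finally show "real (card N - 1) * L \<le> graph_weight \<rho> E"
    by (simp add: graph_weight_def)
qed

text \<open>Any terminal set with any finite superset gives an upper bound, since an infimum lies
  below its members. For real \<open>Inf\<close> this requires lower bounds: nonnegativity of
  \<open>\<rho>\<close> makes 0 one for both infima, also where a denominator vanishes, as division
  by 0 yields 0.\<close>

lemma steiner_ratio_le:
  assumes nonneg: "\<And>x y. x \<in> X \<Longrightarrow> y \<in> X \<Longrightarrow> 0 \<le> \<rho> x y"
    and N: "finite N" "2 \<le> card N" and M: "finite M" "N \<subseteq> M" "M \<subseteq> X"
  shows "steiner_ratio X \<rho> \<le> mst_weight \<rho> M / mst_weight \<rho> N"
proof -
  have mst: "0 \<le> mst_weight \<rho> K" if "finite K" "K \<noteq> {}" "K \<subseteq> X" for K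
    using that by (intro mst_weight_nonneg) (auto intro: nonneg)
  have smt: "0 \<le> smt_weight X \<rho> K" if "finite K" "K \<noteq> {}" "K \<subseteq> X" for K
    unfolding smt_weight_def using that by (intro cInf_greatest) (auto intro!: mst)
  have ne: "K \<noteq> {}" if "2 \<le> card K" for K :: "'a set"
    using that by auto
  have "steiner_ratio X \<rho> \<le> smt_weight X \<rho> N / mst_weight \<rho> N"
    unfolding steiner_ratio_def
  proof (rule cInf_lower)
    show "bdd_below {smt_weight X \<rho> N / mst_weight \<rho> N |N. finite N \<and> N \<subseteq> X \<and> 2 \<le> card N}"
      by (rule bdd_belowI[of _ 0]) (use ne in \<open>auto intro!: divide_nonneg_nonneg mst smt\<close>)
  qed (use N M in auto)
  also have "smt_weight X \<rho> N \<le> mst_weight \<rho> M"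
    unfolding smt_weight_def
  proof (rule cInf_lower)
    show "bdd_below {mst_weight \<rho> M |M. finite M \<and> N \<subseteq> M \<and> M \<subseteq> X}"
      by (rule bdd_belowI[of _ 0]) (use N ne in \<open>auto intro!: mst\<close>)
  qed (use M in auto)
  then have "smt_weight X \<rho> N / mst_weight \<rho> N \<le> mst_weight \<rho> M / mst_weight \<rho> N"
    using N M ne by (intro divide_right_mono mst) auto
  finally show ?thesis .
qed

section \<open>Distances in the Poincare ball\<close>

text \<open>The metric is conformal, so hyperbolic speed is Euclidean speed times a positive
  factor.\<close>

lemma sqrt_lobachevsky_metric:
  assumes "norm p < 1"
  shows "sqrt (lobachevsky_metric p v v) = 2 * norm v / (1 - (norm p)\<^sup>2)"
proof -
  have "(norm p)\<^sup>2 < 1"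
    using assms by (simp add: power_less_one_iff)
  moreover have "lobachevsky_metric p v v = (2 * norm v / (1 - (norm p)\<^sup>2))\<^sup>2"
    by (simp add: lobachevsky_metric_def power_divide power_mult_distrib power2_norm_eq_inner)
  ultimately show ?thesis
    by simp
qed

lemma riemannian_length_linepath:
  assumes "norm x < 1" "norm y < 1"
  shows "has_riemannian_length lobachevsky_metric (linepath x y) l \<longleftrightarrow>
    ((\<lambda>t. 2 * norm (y - x) / (1 - (norm (linepath x y t))\<^sup>2)) has_integral l) {0..1}"
proof -
  have "norm (linepath x y t) < 1" if "t \<in> {0..1}" for t
  proof -
    have "linepath x y t \<in> closed_segment x y"
      using that linepath_in_path by blast
    also have "\<dots> \<subseteq> ball 0 1"
      using assms by (intro closed_segment_subset) auto
    finally show ?thesis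
      by simp
  qed
  then show ?thesis
    unfolding has_riemannian_length_def
    by (intro has_integral_cong) (simp add: sqrt_lobachevsky_metric)
qed

lemma linepath_lobachevsky:
  assumes "norm x < 1" "norm y < 1"
  shows "path_image (linepath x y) \<subseteq> lobachevsky_space"
  using assms closed_segment_subset[of x "ball 0 1" y] by (auto simp: lobachevsky_space_def)

text \<open>Ensures that the infimum defining the distance is over a nonempty set. The ball is
  convex, so the straight segment stays inside it, and its speed is continuous, hence
  integrable.\<close>

lemma ex_lobachevsky_length:
  assumes "norm x < 1" "norm y < 1"
  shows "\<exists>l c. c piecewise_C1_differentiable_on {0..1} \<and> path_image c \<subseteq> lobachevsky_space \<and>
    pathstart c = x \<and> pathfinish c = y \<and> has_riemannian_length lobachevsky_metric c l"
proof -
  have "1 - (norm (linepath x y t))\<^sup>2 \<noteq> 0" if "t \<in> {0..1}" for t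
  proof -
    have "norm (linepath x y t) < 1"
      using linepath_lobachevsky[OF assms] that by (force simp: lobachevsky_space_def path_image_def)
    then show ?thesis
      by (simp add: abs_square_eq_1)
  qed
  then have "continuous_on {0..1} (\<lambda>t. 2 * norm (y - x) / (1 - (norm (linepath x y t))\<^sup>2))"
    by (intro continuous_intros) auto
  then have "(\<lambda>t. 2 * norm (y - x) / (1 - (norm (linepath x y t))\<^sup>2)) integrable_on {0..1}"
    by (rule integrable_continuous_real)
  then have "\<exists>l. has_riemannian_length lobachevsky_metric (linepath x y) l"
    by (simp add: riemannian_length_linepath[OF assms] integrable_on_def)
  then show ?thesis
    using linepath_lobachevsky[OF assms]
    by (metis pathfinish_linepath pathstart_linepath valid_path_linepath[unfolded valid_path_def])
qed

lemma lobachevsky_length_nonneg: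
  assumes "has_riemannian_length lobachevsky_metric c l"
  shows "0 \<le> l"
  using assms unfolding has_riemannian_length_def
  by (rule has_integral_nonneg) (simp add: lobachevsky_metric_def)

lemma lobachevsky_dist_ge:
  assumes "norm x < 1" "norm y < 1"
    and "\<And>c l. c piecewise_C1_differentiable_on {0..1} \<Longrightarrow> path_image c \<subseteq> lobachevsky_space \<Longrightarrow>
      pathstart c = x \<Longrightarrow> pathfinish c = y \<Longrightarrow> has_riemannian_length lobachevsky_metric c l \<Longrightarrow> b \<le> l"
  shows "b \<le> lobachevsky_dist x y"
  unfolding lobachevsky_dist_def riemannian_dist_def
  using ex_lobachevsky_length[OF assms(1,2)] assms(3) by (intro cInf_greatest) blast+

lemma lobachevsky_dist_nonneg:
  assumes "norm x < 1" "norm y < 1"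
  shows "0 \<le> lobachevsky_dist x y"
  using assms by (rule lobachevsky_dist_ge) (rule lobachevsky_length_nonneg)

lemma lobachevsky_dist_le:
  assumes "c piecewise_C1_differentiable_on {0..1}" "path_image c \<subseteq> lobachevsky_space"
    and "has_riemannian_length lobachevsky_metric c l"
  shows "lobachevsky_dist (pathstart c) (pathfinish c) \<le> l"
  unfolding lobachevsky_dist_def riemannian_dist_def
  by (rule cInf_lower) (use assms lobachevsky_length_nonneg in \<open>auto intro!: bdd_belowI[of _ 0]\<close>)

text \<open>The length of the straight segment along a diameter is computed by the fundamental
  theorem of calculus. The absolute value covers both directions of travel.\<close>

lemma lobachevsky_dist_radial:
  assumes "norm u = 1" "\<bar>a\<bar> < 1" "\<bar>b\<bar> < 1"
  shows "lobachevsky_dist (a *\<^sub>R u) (b *\<^sub>R u) \<le> \<bar>ln ((1 + b) / (1 - b)) - ln ((1 + a) / (1 - a))\<bar>"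
proof -
  \<comment> \<open>This is \<open>2 * artanh t\<close>, an antiderivative of the conformal factor
    \<open>2 / (1 - t\<^sup>2)\<close>.\<close>
  define F where "F t = ln (1 + t) - ln (1 - t)" for t :: real
  define w where "w t = a + t * (b - a)" for t
  have w: "\<bar>w t\<bar> < 1" if "t \<in> {0..1}" for t
  proof -
    have "w t = linepath a b t"
      by (simp add: w_def linepath_def algebra_simps)
    also have "\<dots> \<in> closed_segment a b"
      using that linepath_in_path by blast
    also have "\<dots> \<subseteq> ball 0 1"
      using assms by (intro closed_segment_subset) auto
    finally show ?thesis
      by simp
  qed
  \<comment> \<open>The sign turns the velocity \<open>b - a\<close> of \<open>w\<close> into the
    speed \<open>\<bar>b - a\<bar>\<close>.\<close>
  have "((\<lambda>t. sgn (b - a) * F (w t)) has_real_derivative 2 * \<bar>b - a\<bar> / (1 - (w t)\<^sup>2)) (at t within {0..1})"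
    if "t \<in> {0..1}" for t
  proof -
    have pos: "1 + w t > 0" "1 - w t > 0"
      using w[OF that] by auto
    have eq: "1 - (w t)\<^sup>2 = (1 + w t) * (1 - w t)"
      by (simp add: power2_eq_square algebra_simps)
    have "(w has_real_derivative (b - a)) (at t within {0..1})"
      unfolding w_def by (auto intro!: derivative_eq_intros)
    then have "((\<lambda>t. ln (1 + w t) - ln (1 - w t)) has_real_derivative
        (b - a) / (1 + w t) + (b - a) / (1 - w t)) (at t within {0..1})"
      using pos by (auto intro!: derivative_eq_intros simp: field_simps)
    also have "(b - a) / (1 + w t) + (b - a) / (1 - w t) = 2 * (b - a) / (1 - (w t)\<^sup>2)"
      unfolding eq using pos by (simp add: divide_simps) (simp add: algebra_simps)
    finally have "((\<lambda>t. sgn (b - a) * (ln (1 + w t) - ln (1 - w t))) has_real_derivative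
        sgn (b - a) * (2 * (b - a) / (1 - (w t)\<^sup>2))) (at t within {0..1})"
      by (rule DERIV_cmult)
    also have "sgn (b - a) * (2 * (b - a) / (1 - (w t)\<^sup>2)) = 2 * \<bar>b - a\<bar> / (1 - (w t)\<^sup>2)"
      by (simp add: abs_sgn mult.commute)
    finally show ?thesis
      by (simp only: F_def)
  qed
  then have "((\<lambda>t. 2 * \<bar>b - a\<bar> / (1 - (w t)\<^sup>2)) has_integral
      (sgn (b - a) * F (w 1) - sgn (b - a) * F (w 0))) {0..1}"
    by (intro fundamental_theorem_of_calculus)
      (auto simp: has_real_derivative_iff_has_vector_derivative)
  moreover have "linepath (a *\<^sub>R u) (b *\<^sub>R u) t = w t *\<^sub>R u" for t
    by (simp add: linepath_def w_def algebra_simps)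
  moreover have "norm (b *\<^sub>R u - a *\<^sub>R u) = \<bar>b - a\<bar>"
    using assms(1) by (simp flip: scaleR_left_diff_distrib)
  ultimately have "has_riemannian_length lobachevsky_metric (linepath (a *\<^sub>R u) (b *\<^sub>R u))
      (sgn (b - a) * (F b - F a))"
    using assms by (subst riemannian_length_linepath) (simp_all add: w_def right_diff_distrib)
  then have "lobachevsky_dist (a *\<^sub>R u) (b *\<^sub>R u) \<le> sgn (b - a) * (F b - F a)"
    using assms lobachevsky_dist_le[OF valid_path_linepath[unfolded valid_path_def]
        linepath_lobachevsky, of "a *\<^sub>R u" "b *\<^sub>R u"]
    by simp
  also have "\<dots> \<le> \<bar>F b - F a\<bar>"
    by (auto simp: sgn_if)
  finally show ?thesis
    using assms(2,3) by (simp add: F_def ln_div abs_less_iff)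
qed

section \<open>Busemann functions of the ball\<close>

text \<open>For a unit vector \<open>\<xi>\<close> this is minus the usual Busemann function of the
  ideal point \<open>\<xi>\<close>, normalised to vanish at the origin; it grows along the radius
  towards \<open>\<xi>\<close>.\<close>

definition busemann :: "'a::euclidean_space \<Rightarrow> 'a \<Rightarrow> real" where
  "busemann \<xi> x = ln (1 - x \<bullet> x) - ln ((x - \<xi>) \<bullet> (x - \<xi>))"

text \<open>The Euclidean gradient, not the Riemannian one.\<close>

definition busemann_gradient :: "'a::euclidean_space \<Rightarrow> 'a \<Rightarrow> 'a" where
  "busemann_gradient \<xi> x =
     - (2 / (1 - x \<bullet> x)) *\<^sub>R x - (2 / ((x - \<xi>) \<bullet> (x - \<xi>))) *\<^sub>R (x - \<xi>)"

text \<open>The eikonal equation: the Euclidean norm of the gradient is the conformal factor, so its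
  hyperbolic norm is 1.\<close>

lemma norm_busemann_gradient:
  assumes "norm \<xi> = 1" "norm x < 1"
  shows "norm (busemann_gradient \<xi> x) = 2 / (1 - (norm x)\<^sup>2)"
proof -
  define q where "q = 1 - x \<bullet> x"
  define D where "D = (x - \<xi>) \<bullet> (x - \<xi>)"
  have q: "q > 0"
    using assms(2) by (simp add: q_def norm_lt_square)
  have "x \<noteq> \<xi>"
    using assms by auto
  then have D: "D > 0"
    by (simp add: D_def)
  have "\<xi> \<bullet> \<xi> = 1"
    using assms(1) by (simp add: norm_eq_1)
  \<comment> \<open>With this value of the mixed term, the expanded square loses all dependence on
    \<open>D\<close> and only \<open>(2 / q)\<^sup>2\<close> survives.\<close>
  then have xD: "2 * (x \<bullet> (x - \<xi>)) = D - q"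
    by (simp add: D_def q_def inner_diff inner_commute)
  have expand: "(norm (- a *\<^sub>R x - b *\<^sub>R y))\<^sup>2
      = a\<^sup>2 * (x \<bullet> x) + a * b * (2 * (x \<bullet> y)) + b\<^sup>2 * (y \<bullet> y)" for a b y
    unfolding power2_norm_eq_inner
    by (simp add: inner_diff inner_commute algebra_simps power2_eq_square)
  have "busemann_gradient \<xi> x = - (2 / q) *\<^sub>R x - (2 / D) *\<^sub>R (x - \<xi>)"
    by (simp add: busemann_gradient_def q_def D_def)
  then have "(norm (busemann_gradient \<xi> x))\<^sup>2
      = (2 / q)\<^sup>2 * (x \<bullet> x) + (2 / q) * (2 / D) * (2 * (x \<bullet> (x - \<xi>))) + (2 / D)\<^sup>2 * D"
    using expand[of "2 / q" "2 / D" "x - \<xi>"] by (simp add: D_def)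
  also have "\<dots> = (2 / q)\<^sup>2 * (1 - q) + (2 / q) * (2 / D) * (D - q) + (2 / D)\<^sup>2 * D"
    unfolding xD by (simp add: q_def)
  also have "\<dots> = (2 / q)\<^sup>2"
    using q D by (simp add: field_simps power2_eq_square)
  finally have "norm (busemann_gradient \<xi> x) = 2 / q"
    using q by (simp add: power2_eq_iff_nonneg)
  then show ?thesis
    by (simp add: q_def power2_norm_eq_inner)
qed

lemma busemann_has_vector_derivative:
  fixes c :: "real \<Rightarrow> 'a::euclidean_space"
  assumes "norm \<xi> = 1" "norm (c t) < 1" "(c has_vector_derivative v) (at t)"
  shows "((\<lambda>t. busemann \<xi> (c t)) has_vector_derivative (busemann_gradient \<xi> (c t) \<bullet> v)) (at t)"
proof -
  have q: "1 - c t \<bullet> c t > 0"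
    using assms(2) by (simp add: norm_lt_square)
  have "c t \<noteq> \<xi>"
    using assms by auto
  then have D: "(c t - \<xi>) \<bullet> (c t - \<xi>) > 0"
    by simp
  have c: "(c has_derivative (\<lambda>h. h *\<^sub>R v)) (at t)"
    using assms(3) by (simp add: has_vector_derivative_def)
  have dq: "((\<lambda>t. 1 - c t \<bullet> c t) has_real_derivative - 2 * (c t \<bullet> v)) (at t)"
    unfolding has_field_derivative_def
    by (rule derivative_eq_intros c refl)+ (auto simp: inner_commute)
  have dD: "((\<lambda>t. (c t - \<xi>) \<bullet> (c t - \<xi>)) has_real_derivative 2 * ((c t - \<xi>) \<bullet> v)) (at t)"
    unfolding has_field_derivative_def
    by (rule derivative_eq_intros c refl)+ (auto simp: inner_commute)
  have "((\<lambda>t. busemann \<xi> (c t)) has_real_derivative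
      (- 2 * (c t \<bullet> v)) / (1 - c t \<bullet> c t)
      - 2 * ((c t - \<xi>) \<bullet> v) / ((c t - \<xi>) \<bullet> (c t - \<xi>))) (at t)"
    using DERIV_diff[OF DERIV_chain2[OF DERIV_ln_divide[OF q] dq]
        DERIV_chain2[OF DERIV_ln_divide[OF D] dD]]
    unfolding busemann_def by simp
  moreover have "(- 2 * (c t \<bullet> v)) / (1 - c t \<bullet> c t)
      - 2 * ((c t - \<xi>) \<bullet> v) / ((c t - \<xi>) \<bullet> (c t - \<xi>)) = busemann_gradient \<xi> (c t) \<bullet> v"
    by (simp add: busemann_gradient_def inner_diff_left)
  ultimately show ?thesis
    by (simp add: has_real_derivative_iff_has_vector_derivative)
qed

text \<open>Along an admissible curve the derivative of the Busemann function is at most the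
  hyperbolic speed, by Cauchy-Schwarz and the eikonal equation; integration gives the bound.\<close>

lemma busemann_diff_le_lobachevsky_dist:
  assumes \<xi>: "norm \<xi> = 1" and xy: "norm x < 1" "norm y < 1"
  shows "busemann \<xi> y - busemann \<xi> x \<le> lobachevsky_dist x y"
  using xy
proof (rule lobachevsky_dist_ge)
  fix c l
  assume c: "c piecewise_C1_differentiable_on {0..1}" "path_image c \<subseteq> lobachevsky_space"
    "pathstart c = x" "pathfinish c = y" and l: "has_riemannian_length lobachevsky_metric c l"
  have ball: "norm (c t) < 1" if "t \<in> {0..1}" for t
    using c(2) that by (force simp: path_image_def lobachevsky_space_def)
  obtain S where cont: "continuous_on {0..1} c" and S: "finite S"
    and "c C1_differentiable_on ({0..1} - S)"
    using c(1) by (auto simp: piecewise_C1_differentiable_on_def)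
  then have deriv: "(c has_vector_derivative vector_derivative c (at t)) (at t)" if "t \<in> {0..1} - S" for t
    using that by (simp add: C1_differentiable_on_eq vector_derivative_works)
  have "((\<lambda>t. busemann_gradient \<xi> (c t) \<bullet> vector_derivative c (at t)) has_integral
      (busemann \<xi> (c 1) - busemann \<xi> (c 0))) {0..1}"
  \<comment> \<open>This version tolerates the finite set \<open>S\<close> of break points, across
    which continuity suffices.\<close>
  proof (rule fundamental_theorem_of_calculus_interior_strong[OF S])
    have "1 - c t \<bullet> c t \<noteq> 0" "c t \<noteq> \<xi>" if "t \<in> {0..1}" for t
      using ball[OF that] \<xi> by (auto simp flip: norm_eq_1)
    then show "continuous_on {0..1} (\<lambda>t. busemann \<xi> (c t))"
      unfolding busemann_def by (auto intro!: continuous_intros cont)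
    fix t :: real assume "t \<in> {0<..<1} - S"
    then show "((\<lambda>t. busemann \<xi> (c t)) has_vector_derivative
        busemann_gradient \<xi> (c t) \<bullet> vector_derivative c (at t)) (at t)"
      by (intro busemann_has_vector_derivative[OF \<xi>] ball deriv) auto
  qed simp
  then have "busemann \<xi> (c 1) - busemann \<xi> (c 0) \<le> l"
  proof (rule has_integral_le)
    show "((\<lambda>t. sqrt (lobachevsky_metric (c t) (vector_derivative c (at t)) (vector_derivative c (at t))))
        has_integral l) {0..1}"
      using l by (simp add: has_riemannian_length_def)
    \<comment> \<open>Break points are included: the comparison holds for every vector, whatever
      value \<open>vector_derivative\<close> has there.\<close>
    fix t :: real assume t: "t \<in> {0..1}"
    let ?v = "vector_derivative c (at t)"
    have "busemann_gradient \<xi> (c t) \<bullet> ?v \<le> norm (busemann_gradient \<xi> (c t)) * norm ?v"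
      by (rule norm_cauchy_schwarz)
    then show "busemann_gradient \<xi> (c t) \<bullet> ?v \<le> sqrt (lobachevsky_metric (c t) ?v ?v)"
      using ball[OF t] by (simp add: norm_busemann_gradient[OF \<xi>] sqrt_lobachevsky_metric)
  qed
  then show "busemann \<xi> y - busemann \<xi> x \<le> l"
    using c(3,4) by (simp add: pathstart_def pathfinish_def)
qed

text \<open>The Busemann function of \<open>v\<close> is evaluated at both points. With
  \<open>r = ln ((1 + s) / (1 - s))\<close> it is \<open>r\<close> at \<open>s *\<^sub>R v\<close>
  and at most \<open>ln 2 - r\<close> at \<open>s *\<^sub>R u\<close>.\<close>

lemma lobachevsky_dist_obtuse:
  assumes "norm u = 1" "norm v = 1" "u \<bullet> v \<le> 0" and s: "0 \<le> s" "s < 1"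
  shows "2 * ln ((1 + s) / (1 - s)) - ln 2 \<le> lobachevsky_dist (s *\<^sub>R u) (s *\<^sub>R v)"
proof -
  have uv: "u \<bullet> u = 1" "v \<bullet> v = 1"
    using assms(1,2) by (simp_all add: norm_eq_1)
  have q: "1 - s * s = (1 + s) * (1 - s)"
    by (simp add: algebra_simps)
  have "(s *\<^sub>R v - v) \<bullet> (s *\<^sub>R v - v) = (1 - s) * (1 - s)"
    using uv by (simp add: inner_diff algebra_simps)
  then have v: "busemann v (s *\<^sub>R v) = ln ((1 + s) / (1 - s))"
    using uv s by (simp add: busemann_def q ln_mult ln_div)
  have "(s *\<^sub>R u - v) \<bullet> (s *\<^sub>R u - v) = 1 + s * s - 2 * s * (u \<bullet> v)"
    using uv by (simp add: inner_diff inner_commute algebra_simps)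
  \<comment> \<open>The source of \<open>ln 2\<close>: a multiple of \<open>(1 + s)\<^sup>2\<close>
    combines with \<open>1 - s * s = (1 + s) * (1 - s)\<close> under the logarithm.\<close>
  moreover have "(1 + s)\<^sup>2 / 2 \<le> 1 + s * s"
    using zero_le_power2[of "1 - s"] by (simp add: power2_eq_square algebra_simps)
  moreover have "s * (u \<bullet> v) \<le> 0"
    using assms by (simp add: mult_nonneg_nonpos)
  ultimately have "(1 + s)\<^sup>2 / 2 \<le> (s *\<^sub>R u - v) \<bullet> (s *\<^sub>R u - v)"
    by linarith
  then have "ln ((1 + s)\<^sup>2 / 2) \<le> ln ((s *\<^sub>R u - v) \<bullet> (s *\<^sub>R u - v))"
    using s by (intro ln_mono) auto
  then have "busemann v (s *\<^sub>R u) \<le> ln 2 - ln ((1 + s) / (1 - s))"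
    using uv s by (simp add: busemann_def q ln_mult ln_div power2_eq_square)
  with v have "2 * ln ((1 + s) / (1 - s)) - ln 2 \<le> busemann v (s *\<^sub>R v) - busemann v (s *\<^sub>R u)"
    by simp
  also have "\<dots> \<le> lobachevsky_dist (s *\<^sub>R u) (s *\<^sub>R v)"
    using assms by (intro busemann_diff_le_lobachevsky_dist) auto
  finally show ?thesis .
qed

section \<open>The three-point configuration and its limit\<close>

text \<open>Two coordinate axes supply the directions \<open>u\<close>, \<open>v\<close>,
  \<open>- u\<close>, which is where dimension at least 2 enters. The condition
  \<open>ln 2 < r\<close> keeps the lower bound on the edges, and hence the denominator,
  positive.\<close>

lemma steiner_ratio_lobachevsky_le:
  assumes card: "2 \<le> CARD('n::finite)" and r: "ln 2 < r"
  shows "steiner_ratio (lobachevsky_space :: (real ^ 'n) set) lobachevsky_dist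
    \<le> 3 * r / (2 * (2 * r - ln 2))"
proof -
  obtain i j :: 'n where ij: "i \<noteq> j"
    using card by (metis card_2_iff' ex_card)
  define u v :: "real ^ 'n" where "u = axis i 1" and "v = axis j 1"
  have unit: "norm u = 1" "norm v = 1"
    by (simp_all add: u_def v_def)
  have orth: "u \<bullet> v = 0"
    using ij by (simp add: u_def v_def inner_axis_axis)
  have "x \<noteq> y" if "u \<bullet> x \<noteq> u \<bullet> y" for x y
    using that by blast
  \<comment> \<open>The inner products of \<open>u\<close> with \<open>u\<close>, \<open>v\<close>,
    \<open>- u\<close> are 1, 0, -1.\<close>
  then have ne: "u \<noteq> v" "u \<noteq> - u" "v \<noteq> - u"
    using unit orth by (simp_all only: norm_eq_1 inner_minus_right) simp_all
  define U where "U = {u, v, - u}"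
  have U: "norm x = 1" if "x \<in> U" for x
    using that unit by (auto simp: U_def)
  have obtuse: "x \<bullet> y \<le> 0" if "x \<in> U" "y \<in> U" "x \<noteq> y" for x y
    using that orth by (auto simp: U_def inner_commute)
  \<comment> \<open>This is \<open>tanh (r / 2)\<close>, the Euclidean radius of the hyperbolic
    sphere of radius \<open>r\<close> about the origin.\<close>
  define s where "s = (exp r - 1) / (exp r + 1)"
  have "r > 0"
    using r ln_gt_zero[of 2] by linarith
  then have s: "0 < s" "s < 1"
    by (simp_all add: s_def divide_simps add_pos_pos)
  have "(1 + s) / (1 - s) = exp r"
    by (simp add: s_def divide_simps add_pos_pos) (smt (verit) exp_gt_zero)
  then have F: "ln ((1 + s) / (1 - s)) = r"
    by simp
  define N where "N = (*\<^sub>R) s ` U"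
  have cardU: "card U = 3"
    using ne by (simp add: U_def)
  have N: "finite N" "card N = 3" "0 \<notin> N"
    using s cardU U[of 0] by (auto simp: N_def card_image inj_on_def card_ge_0_finite)
  \<comment> \<open>The origin is the only Steiner point added.\<close>
  have "steiner_ratio (lobachevsky_space :: (real ^ 'n) set) lobachevsky_dist
      \<le> mst_weight lobachevsky_dist (insert 0 N) / mst_weight lobachevsky_dist N"
    using N s U by (intro steiner_ratio_le lobachevsky_dist_nonneg)
      (auto simp: lobachevsky_space_def N_def)
  also have "\<dots> \<le> 3 * r / (2 * (2 * r - ln 2))"
  proof (rule frac_le)
    have radial: "lobachevsky_dist 0 x + lobachevsky_dist x 0 \<le> 2 * r" if "x \<in> N" for x
    proof -
      obtain w where w: "x = s *\<^sub>R w" "norm w = 1"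
        using \<open>x \<in> N\<close> U by (auto simp: N_def)
      show ?thesis
        using lobachevsky_dist_radial[OF w(2), of 0 s] lobachevsky_dist_radial[OF w(2), of s 0] s F
          \<open>r > 0\<close> by (simp add: w(1))
    qed
    have "mst_weight lobachevsky_dist (insert 0 N)
        \<le> (\<Sum>x\<in>insert 0 N - {0}. lobachevsky_dist 0 x + lobachevsky_dist x 0) / 2"
      using N by (intro mst_weight_le_star) auto
    also have "\<dots> \<le> (real (card N) * (2 * r)) / 2"
      using N sum_bounded_above[of N, OF radial] by (intro divide_right_mono) simp_all
    finally show "mst_weight lobachevsky_dist (insert 0 N) \<le> 3 * r"
      using N by simp
    have "real (card N - 1) * (2 * r - ln 2) \<le> mst_weight lobachevsky_dist N"
    proof (rule mst_weight_ge)
      fix x y assume "x \<in> N" "y \<in> N" "x \<noteq> y"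
      then obtain a b where ab: "x = s *\<^sub>R a" "y = s *\<^sub>R b" "a \<in> U" "b \<in> U" "a \<noteq> b"
        by (auto simp: N_def)
      then show "2 * r - ln 2 \<le> lobachevsky_dist x y"
        using lobachevsky_dist_obtuse[of a b s] U obtuse s F by simp
    qed (use N r \<open>r > 0\<close> in auto)
    then show "2 * (2 * r - ln 2) \<le> mst_weight lobachevsky_dist N"
      using N by simp
  qed (use r \<open>r > 0\<close> in auto)
  finally show ?thesis .
qed

theorem theorem1p3:
  assumes "2 \<le> CARD('n::finite)"
  shows "steiner_ratio (lobachevsky_space :: (real ^ 'n) set) lobachevsky_dist \<le> 3 / 4"
proof (rule tendsto_lowerbound)
  \<comment> \<open>Each single \<open>r > ln 2\<close> gives a bound strictly above 3/4, so the
    limit is essential.\<close>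
  show "((\<lambda>r. 3 * r / (2 * (2 * r - ln 2))) \<longlongrightarrow> 3 / 4) (at_top :: real filter)"
    by real_asymp
  show "\<forall>\<^sub>F r in at_top. steiner_ratio (lobachevsky_space :: (real ^ 'n) set) lobachevsky_dist
      \<le> 3 * r / (2 * (2 * r - ln 2))"
    using eventually_gt_at_top[of "ln 2"]
    by eventually_elim (rule steiner_ratio_lobachevsky_le[OF assms])
qed simp

end
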